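(* Let $X$ be a topological space. Then $\mathcal{C}(X,X) = \mathrm{Map}(X,X)$ if and only if $X$ has the trivial topology or the discrete topology.
   Context: $\mathcal{C}(X,X)$ is the set of continuous maps from $X$ to $X$, and $\mathrm{Map}(X,X)$ is the set of all maps from $X$ to $X$. The trivial topology is the one whose only open sets are $\emptyset$ and $X$. *)

theory Defs
  imports "HOL-Analysis.Analysis"
begin

text \<open>
  HOL functions are total, so a map between the carriers of two topologies is represented by
  its extensional representative, which takes the value \<^const>\<open>undefined\<close> off the carrier.
\<close>

definition all_maps :: "'a topology \<Rightarrow> 'b topology \<Rightarrow> ('a \<Rightarrow> 'b) set" where
  "all_maps X Y = topspace X \<rightarrow>\<^sub>E topspace Y"

definition continuous_maps :: "'a topology \<Rightarrow> 'b topology \<Rightarrow> ('a \<Rightarrow> 'b) set" where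
  "continuous_maps X Y = {f \<in> all_maps X Y. continuous_map X Y f}"

text \<open>
  The library's \<^term>\<open>trivial_topology\<close> is the topology on the empty carrier; the notion
  below is the indiscrete topology on an arbitrary carrier.
\<close>

definition has_trivial_topology :: "'a topology \<Rightarrow> bool" where
  "has_trivial_topology X \<longleftrightarrow> {U. openin X U} = {{}, topspace X}"

definition has_discrete_topology :: "'a topology \<Rightarrow> bool" where
  "has_discrete_topology X \<longleftrightarrow> X = discrete_topology (topspace X)"

end

theory Submission
  imports Defs
begin

text \<open>If some open \<open>U\<close> is neither empty nor the whole carrier, pick
  \<open>a\<close> inside it and \<open>b\<close> outside. A map sending \<open>S\<close> to
  \<open>a\<close> and the rest to \<open>b\<close> pulls \<open>U\<close> back to \<open>S\<close>;
  if all maps are continuous, every \<open>S\<close> is therefore open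
  (\<open>openin_continuous_map_preimage\<close>) and the space is discrete. Conversely, every map
  out of a discrete space is continuous, and over a trivial topology only the preimages of the empty
  set and of the carrier need checking.\<close>

theorem corollary1:
  fixes X :: "'a topology"
  shows "continuous_maps X X = all_maps X X \<longleftrightarrow>
    has_trivial_topology X \<or> has_discrete_topology X"
proof
  assume eq: "continuous_maps X X = all_maps X X"
  show "has_trivial_topology X \<or> has_discrete_topology X"
  proof (rule disjCI)
    assume nd: "\<not> has_discrete_topology X"
    have "U = {} \<or> U = topspace X" if U: "openin X U" for U
    proof (rule ccontr)
      assume "\<not> (U = {} \<or> U = topspace X)"
      then obtain a b where ab: "a \<in> U" "a \<in> topspace X" "b \<in> topspace X" "b \<notin> U"
        using openin_subset[OF U] by blast
      have "openin X S" if S: "S \<subseteq> topspace X" for S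
      proof -
        \<comment> \<open>every subset is the preimage of the proper open set U under a two-valued map\<close>
        define f where "f = (\<lambda>x\<in>topspace X. if x \<in> S then a else b)"
        have "f \<in> all_maps X X"
          using ab by (auto simp: all_maps_def f_def)
        then have "continuous_map X X f"
          using eq by (auto simp: continuous_maps_def)
        then have "openin X {x \<in> topspace X. f x \<in> U}"
          using U by (rule openin_continuous_map_preimage)
        moreover have "{x \<in> topspace X. f x \<in> U} = S"
          using S ab by (auto simp: f_def)
        ultimately show ?thesis by simp
      qed
      \<comment> \<open>A topology is determined by its open sets, here exactly the subsets of the
        carrier.\<close>
      then have "X = discrete_topology (topspace X)"
        by (auto simp: topology_eq dest: openin_subset)
      with nd show False by (simp add: has_discrete_topology_def)
    qed
    then show "has_trivial_topology X"
      by (auto simp: has_trivial_topology_def)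
  qed
next
  assume "has_trivial_topology X \<or> has_discrete_topology X"
  then have "continuous_map X X f" if f: "f \<in> all_maps X X" for f
  proof
    assume "has_trivial_topology X"
    then have triv: "openin X U \<longleftrightarrow> U = {} \<or> U = topspace X" for U
      \<comment> \<open>The instantiation confines extensionality to the equation between families
        of open sets, leaving \<open>U = {}\<close> and \<open>U = topspace X\<close>
        intact.\<close>
      by (auto simp: has_trivial_topology_def set_eq_iff[of "Collect _"])
    \<comment> \<open>The one preimage that needs \<open>f\<close> to map the carrier into
      itself.\<close>
    have "{x \<in> topspace X. f x \<in> topspace X} = topspace X"
      using f by (auto simp: all_maps_def)
    then show ?thesis
      using f by (auto simp: continuous_map_def triv all_maps_def)
  next
    assume "has_discrete_topology X"
    then have "X = discrete_topology (topspace X)"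
      by (simp add: has_discrete_topology_def)
    moreover have "f \<in> topspace X \<rightarrow> topspace X"
      using f by (auto simp: all_maps_def)
    ultimately show ?thesis
      by (metis continuous_map_from_discrete_topology)
  qed
  then show "continuous_maps X X = all_maps X X"
    by (auto simp: continuous_maps_def)
qed

end
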